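(* Let $\mathcal{A}$ be a unital Banach algebra, let $n\geq 1$ be an integer, and let $a_0,a_1,\dots,a_{n-1}\in\mathcal{A}$. Let $p(z)=a_0+a_1z+\cdots+a_{n-1}z^{n-1}+z^n\in\mathcal{A}[z]$. Let $u\in\mathcal{A}$ be such that $p(u)=0$ and $\|u^n\|=\|u\|^n$. Then $$\|u\|\leq\max\left\{1,\sum_{j=0}^{n-1}\|a_j\|\right\}.$$
   Context: Here $\mathcal{A}$ is a (possibly noncommutative) Banach algebra with unit $1\neq 0$, and $\mathcal{A}[z]$ is the set of polynomials over $\mathcal{A}$. Coefficients are written on the left of the powers of $z$, and $p(u)$ means $p(u)=a_0+a_1u+\cdots+a_{n-1}u^{n-1}+u^n$. *)

theory Defs
  imports Complex_Main "HOL-Computational_Algebra.Polynomial"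
begin

text \<open>
  Evaluation of a polynomial with coefficients written on the left of the powers of the
  variable. The library function \<^const>\<open>poly\<close> is not usable here, because it is restricted to
  commutative coefficient structures.
\<close>

definition left_eval :: "'a::ring_1 poly \<Rightarrow> 'a \<Rightarrow> 'a" where
  "left_eval p u = (\<Sum>i\<le>degree p. coeff p i * u ^ i)"

end

theory Submission
  imports Defs
begin

text \<open>
  If \<open>norm u \<le> 1\<close> there is nothing to do. Otherwise the equation \<open>p(u) = 0\<close> gives
  \<open>u ^ n = - (\<Sum>j<n. a j * u ^ j)\<close>. Since the powers of a number greater than one increase, every
  summand has norm at most \<open>norm (a j) * norm u ^ (n - 1)\<close>, while the left-hand side has norm
  exactly \<open>norm u ^ n\<close> by the norm hypothesis on \<open>u\<close>. Cancelling \<open>norm u ^ (n - 1)\<close> leaves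
  the claimed bound.
\<close>

text \<open>
  The unit may have norm greater than one here, so \<open>norm (u ^ j) \<le> norm u ^ j\<close> can fail for
  \<open>j = 0\<close>. With a factor \<open>x\<close> in front the estimate survives, because \<open>x * u ^ 0\<close> is just \<open>x\<close>.
\<close>

lemma norm_mult_power_le:
  fixes x u :: "'a :: {real_normed_algebra, real_algebra_1}"
  shows "norm (x * u ^ j) \<le> norm x * norm u ^ j"
proof (induction j)
  case 0
  show ?case by simp
next
  case (Suc j)
  have "norm (x * u ^ Suc j) = norm ((x * u ^ j) * u)"
    by (simp only: power_Suc2 mult.assoc)
  also have "\<dots> \<le> norm (x * u ^ j) * norm u"
    by (rule norm_mult_ineq)
  also have "\<dots> \<le> (norm x * norm u ^ j) * norm u"
    by (intro mult_right_mono Suc.IH norm_ge_zero)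
  finally show ?case
    by (simp only: power_Suc2 mult.assoc)
qed

lemma coeff_monic:
  fixes a :: "nat \<Rightarrow> 'a :: ring_1"
  shows "coeff ((\<Sum>j<n. monom (a j) j) + monom 1 n) i =
    (if i < n then a i else if i = n then 1 else 0)"
proof -
  have "(\<Sum>j<n. coeff (monom (a j) j) i) = (if i < n then a i else 0)"
    by (simp add: sum.delta)
  then show ?thesis
    by (simp add: coeff_sum)
qed

lemma left_eval_monic:
  fixes a :: "nat \<Rightarrow> 'a :: ring_1"
  shows "left_eval ((\<Sum>j<n. monom (a j) j) + monom 1 n) u = (\<Sum>j<n. a j * u ^ j) + u ^ n"
    (is "left_eval ?p u = _")
proof -
  have "coeff ?p n \<noteq> 0" and "\<forall>i>n. coeff ?p i = 0"
    by (simp_all only: coeff_monic) simp_all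
  then have "degree ?p = n"
    by (intro antisym degree_le le_degree)
  then have "left_eval ?p u = (\<Sum>i<Suc n. coeff ?p i * u ^ i)"
    by (simp add: left_eval_def lessThan_Suc_atMost)
  also have "\<dots> = (\<Sum>i<n. coeff ?p i * u ^ i) + u ^ n"
    by (simp only: sum.lessThan_Suc coeff_monic) simp
  also have "(\<Sum>i<n. coeff ?p i * u ^ i) = (\<Sum>j<n. a j * u ^ j)"
    by (intro sum.cong refl) (simp only: coeff_monic lessThan_iff if_True)
  finally show ?thesis .
qed

theorem theorem2p8:
  fixes a :: "nat \<Rightarrow> 'a :: {real_normed_algebra, real_algebra_1, banach}"
    and n :: nat
    and p :: "'a poly"
    and u :: 'a
  assumes "n \<ge> 1"
    and "p = (\<Sum>j<n. monom (a j) j) + monom 1 n"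
    and "left_eval p u = 0"
    and "norm (u ^ n) = norm u ^ n"
  shows "norm u \<le> max 1 (\<Sum>j<n. norm (a j))"
proof (cases "norm u \<le> 1")
  case True
  then show ?thesis by simp
next
  case False
  then have gt1: "norm u > 1" by simp
  have "(\<Sum>j<n. a j * u ^ j) + u ^ n = 0"
    using assms(2,3) by (simp only: left_eval_monic)
  then have root: "u ^ n = - (\<Sum>j<n. a j * u ^ j)"
    by (simp only: add_eq_0_iff)
  have "norm u * norm u ^ (n - 1) = norm (u ^ n)"
    using assms(1,4) power_minus_mult[of n "norm u"] by (simp add: mult.commute)
  also have "\<dots> \<le> (\<Sum>j<n. norm (a j * u ^ j))"
    by (simp only: root norm_minus_cancel norm_sum)
  also have "\<dots> \<le> (\<Sum>j<n. norm (a j) * norm u ^ (n - 1))"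
  proof (rule sum_mono)
    fix j assume "j \<in> {..<n}"
    then have "norm u ^ j \<le> norm u ^ (n - 1)"
      using gt1 by (intro power_increasing) auto
    then show "norm (a j * u ^ j) \<le> norm (a j) * norm u ^ (n - 1)"
      by (intro order_trans[OF norm_mult_power_le] mult_left_mono norm_ge_zero)
  qed
  also have "\<dots> = (\<Sum>j<n. norm (a j)) * norm u ^ (n - 1)"
    by (simp only: sum_distrib_right)
  finally have "norm u \<le> (\<Sum>j<n. norm (a j))"
    by (rule mult_right_le_imp_le) (rule zero_less_power, use gt1 in linarith)
  then show ?thesis by simp
qed

end
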